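(* Let $(X,\mathscr{E})$ be a coarse space with $\operatorname{asdim}(X)\le k$ and fix $x_0\in X$. Then the coarse free product $(\ast X,\ast\mathscr{E})$ taken with respect to the basepoint $x_0$ satisfies $\operatorname{asdim}(\ast X)\le 2k+1$.
   Context: Coarse spaces. For $E,F\subset X\times X$ put $E\circ F=\{(x,z): \exists y,\ (x,y)\in E,\ (y,z)\in F\}$, $E^{-1}=\{(y,x):(x,y)\in E\}$, and let $\Delta$ be the diagonal. A coarse structure on $X$ is a collection $\mathscr{E}$ of subsets of $X\times X$ (called entourages) containing $\Delta$ and closed under inverses, finite unions, subsets and compositions; $(X,\mathscr{E})$ is then a coarse space. A family $\mathcal{U}$ of subsets of $X$ is $E$-disjoint if $(U\times U')\cap E=\emptyset$ for distinct $U,U'\in\mathcal{U}$, and $K$-bounded if $\bigcup_{U\in\mathcal{U}}U\times U\subset K$. Asymptotic dimension. For $n\in\mathbb{Z}_{\ge0}$, $\operatorname{asdim}X\le n$ means: for every $E\in\mathscr{E}$ there are families $\mathcal{U}_0,\dots,\mathcal{U}_n$ of subsets of $X$ such that $\bigcup_i\mathcal{U}_i$ covers $X$, each $\mathcal{U}_i$ is $E$-disjoint, and there is $K\in\mathscr{E}$ such that each $\mathcal{U}_i$ is $K$-bounded. Coarse free product. $\ast X$ is the set of finite words in the alphabet $X\setminus\{x_0\}$, including the empty word $\boldsymbol{\epsilon}$, which is identified with $x_0$. For $E\in\mathscr{E}$ let $E^k$ be the $k$-fold composition ($k\ge1$), $E^0=E\cap\Delta$, and $D_E(x,y)=\min\{k\ge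 0:(x,y)\in E^k\}\in\mathbb{Z}_{\ge0}\cup\{+\infty\}$ ($\min\emptyset=+\infty$). For $\mathbf{x}=x_1\cdots x_k\in\ast X$ put $\|\mathbf{x}\|_E=\sum_i D_E(x_0,x_i)$, $\|\mathbf{x}\|^E=\sum_i D_E(x_i,x_0)$, and $\|\boldsymbol{\epsilon}\|_E=\|\boldsymbol{\epsilon}\|^E=0$. Distinct words are written uniquely as $\mathbf{x}=\mathbf{a}b\mathbf{c}$, $\mathbf{x}'=\mathbf{a}b'\mathbf{c}'$, where $\mathbf{a}$ is their longest common prefix and $b\ne b'$ are the next letters (if $\mathbf{x}=\mathbf{a}$ then $b=x_0$, $\mathbf{c}=\boldsymbol{\epsilon}$; similarly for $\mathbf{x}'$). Put $D^*_E(\mathbf{x},\mathbf{x})=0$ and $D_E^*(\mathbf{x},\mathbf{x}')=D_E(b,b')+\|\mathbf{c}\|_E+\|\mathbf{c}'\|^E$ for $\mathbf{x}\ne\mathbf{x}'$. Let $\langle E,n\rangle=\{(\mathbf{x},\mathbf{x}'): D_E^*(\mathbf{x},\mathbf{x}')\le n\}$. The coarse structure $\ast\mathscr{E}$ consists of all subsets of the sets $\langle E,n\rangle$, $E\in\mathscr{E}$, $n\in\mathbb{N}$. *)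

theory Defs
  imports Main "HOL-Library.Extended_Nat" "HOL-Library.Sublist"
begin

section \<open>Coarse spaces and asymptotic dimension\<close>

text \<open>The order of composition in \<open>O\<close> is the diagrammatic one:
  \<open>(x, z) \<in> E O F\<close> iff \<open>(x, y) \<in> E\<close> and \<open>(y, z) \<in> F\<close> for some \<open>y\<close>.\<close>

locale coarse_space =
  fixes X :: "'a set" and \<E> :: "'a rel set"
  assumes entourage_subset: "E \<in> \<E> \<Longrightarrow> E \<subseteq> X \<times> X"
    and diagonal: "Id_on X \<in> \<E>"
    and converse_closed: "E \<in> \<E> \<Longrightarrow> E\<inverse> \<in> \<E>"
    and union_closed: "E \<in> \<E> \<Longrightarrow> F \<in> \<E> \<Longrightarrow> E \<union> F \<in> \<E>"
    and subset_closed: "E \<in> \<E> \<Longrightarrow> F \<subseteq> E \<Longrightarrow> F \<in> \<E>"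
    and comp_closed: "E \<in> \<E> \<Longrightarrow> F \<in> \<E> \<Longrightarrow> E O F \<in> \<E>"

definition rel_disjoint :: "'a rel \<Rightarrow> 'a set set \<Rightarrow> bool" where
  "rel_disjoint E \<U> \<longleftrightarrow> (\<forall>U\<in>\<U>. \<forall>U'\<in>\<U>. U \<noteq> U' \<longrightarrow> (U \<times> U') \<inter> E = {})"

definition rel_bounded :: "'a rel \<Rightarrow> 'a set set \<Rightarrow> bool" where
  "rel_bounded K \<U> \<longleftrightarrow> (\<Union>U\<in>\<U>. U \<times> U) \<subseteq> K"

definition asdim_le :: "'a set \<Rightarrow> 'a rel set \<Rightarrow> nat \<Rightarrow> bool" where
  "asdim_le X \<E> n \<longleftrightarrow>
     (\<forall>E\<in>\<E>. \<exists>\<U> :: nat \<Rightarrow> 'a set set.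
        (\<forall>i\<le>n. \<U> i \<subseteq> Pow X) \<and>
        X \<subseteq> (\<Union>i\<le>n. \<Union>(\<U> i)) \<and>
        (\<forall>i\<le>n. rel_disjoint E (\<U> i)) \<and>
        (\<exists>K\<in>\<E>. \<forall>i\<le>n. rel_bounded K (\<U> i)))"

section \<open>The coarse free product\<close>

definition words :: "'a set \<Rightarrow> 'a \<Rightarrow> 'a list set" where
  "words X x0 = lists (X - {x0})"

text \<open>The zeroth power is \<open>E \<inter> Id\<close>, whereas \<open>E ^^ 0\<close> is all of \<open>Id\<close>.\<close>

definition ent_pow :: "'a rel \<Rightarrow> nat \<Rightarrow> 'a rel" where
  "ent_pow E k = (if k = 0 then E \<inter> Id else E ^^ k)"

text \<open>In \<^typ>\<open>enat\<close> the infimum of a nonempty set is its minimum and \<open>Inf {} = \<infinity>\<close>.\<close>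

definition ent_dist :: "'a rel \<Rightarrow> 'a \<Rightarrow> 'a \<Rightarrow> enat" where
  "ent_dist E x y = Inf {enat k |k. (x, y) \<in> ent_pow E k}"

text \<open>\<open>norm_out\<close> is the norm with lower index \<open>E\<close> (distances from the basepoint),
  \<open>norm_in\<close> the one with upper index \<open>E\<close> (distances to the basepoint).\<close>

definition norm_out :: "'a \<Rightarrow> 'a rel \<Rightarrow> 'a list \<Rightarrow> enat" where
  "norm_out x0 E w = (\<Sum>x\<leftarrow>w. ent_dist E x0 x)"

definition norm_in :: "'a \<Rightarrow> 'a rel \<Rightarrow> 'a list \<Rightarrow> enat" where
  "norm_in x0 E w = (\<Sum>x\<leftarrow>w. ent_dist E x x0)"

text \<open>The empty word stands for the basepoint; in particular, when nothing is left of a word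
  after its common prefix with another one, its next letter is \<open>x0\<close>.\<close>

definition first_letter :: "'a \<Rightarrow> 'a list \<Rightarrow> 'a" where
  "first_letter x0 w = (case w of [] \<Rightarrow> x0 | b # c \<Rightarrow> b)"

text \<open>Below, \<open>r\<close> and \<open>r'\<close> are the words \<open>bc\<close> and \<open>b'c'\<close> that remain after the longest
  common prefix \<open>a\<close>; \<open>tl\<close> yields \<open>c\<close> and \<open>c'\<close>, also for an empty remainder, as \<open>tl [] = []\<close>.\<close>

definition word_dist :: "'a \<Rightarrow> 'a rel \<Rightarrow> 'a list \<Rightarrow> 'a list \<Rightarrow> enat" where
  "word_dist x0 E w w' =
     (if w = w' then 0
      else let a = longest_common_prefix w w';
               r = drop (length a) w;
               r' = drop (length a) w'
           in ent_dist E (first_letter x0 r) (first_letter x0 r')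
              + norm_out x0 E (tl r) + norm_in x0 E (tl r'))"

definition word_ent :: "'a set \<Rightarrow> 'a \<Rightarrow> 'a rel \<Rightarrow> nat \<Rightarrow> 'a list rel" where
  "word_ent X x0 E n =
     {(w, w'). w \<in> words X x0 \<and> w' \<in> words X x0 \<and> word_dist x0 E w w' \<le> enat n}"

definition free_product_structure :: "'a set \<Rightarrow> 'a \<Rightarrow> 'a rel set \<Rightarrow> 'a list rel set" where
  "free_product_structure X x0 \<E> = {F. \<exists>E\<in>\<E>. \<exists>n. F \<subseteq> word_ent X x0 E n}"

end

theory Submission
  imports Defs
begin

text \<open>The free product is a tree of copies of \<open>X\<close>, so the annulus argument for trees applies.
  Given \<open>E\<close> and \<open>n\<close>, cut the words into annuli of width \<open>R = n + 1\<close> according to their norm.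
  In the annulus starting at height \<open>j R\<close>, let \<open>u\<close> be the shortest prefix of a word of norm at
  least \<open>j R - n\<close>, and group words that share all of \<open>u\<close> but its last letter, this last letter
  being taken in one member of a cover of \<open>X\<close>. The parity of \<open>j\<close> together with the
  \<open>k + 1\<close> colours of the cover gives \<open>2 k + 2\<close> families. Letters at infinite distance from the
  basepoint are given a large finite norm.\<close>

section \<open>Asymptotic dimension via coloured partitions\<close>

text \<open>The members of the cover are the common level sets of a colour and a key, with one
  family per colour, so disjointness and boundedness become conditions on pairs of points.\<close>

lemma asdim_le_partitionI:
  assumes ex: "\<And>E. E \<in> \<E> \<Longrightarrow> \<exists>(col :: 'a \<Rightarrow> nat) (key :: 'a \<Rightarrow> 'k). \<exists>K\<in>\<E>. \<forall>x\<in>X. col x \<le> n \<and>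
      (\<forall>y\<in>X. col x = col y \<longrightarrow> ((x, y) \<in> E \<longrightarrow> key x = key y) \<and> (key x = key y \<longrightarrow> (x, y) \<in> K))"
  shows "asdim_le X \<E> n"
  unfolding asdim_le_def
proof
  fix E assume "E \<in> \<E>"
  from ex[OF this] obtain col :: "'a \<Rightarrow> nat" and key :: "'a \<Rightarrow> 'k" and K where K: "K \<in> \<E>"
    and part: "\<forall>x\<in>X. col x \<le> n \<and> (\<forall>y\<in>X. col x = col y \<longrightarrow>
      ((x, y) \<in> E \<longrightarrow> key x = key y) \<and> (key x = key y \<longrightarrow> (x, y) \<in> K))"
    by (elim exE bexE)
  have col: "col x \<le> n" if "x \<in> X" for x
    using part that by blast
  have dis: "key x = key y" if "x \<in> X" "y \<in> X" "col x = col y" "(x, y) \<in> E" for x y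
    using part that by blast
  have bdd: "(x, y) \<in> K" if "x \<in> X" "y \<in> X" "col x = col y" "key x = key y" for x y
    using part that by blast
  define cell where "cell i \<kappa> = {x\<in>X. col x = i \<and> key x = \<kappa>}" for i \<kappa>
  show "\<exists>\<U>. (\<forall>i\<le>n. \<U> i \<subseteq> Pow X) \<and> X \<subseteq> (\<Union>i\<le>n. \<Union> (\<U> i)) \<and>
      (\<forall>i\<le>n. rel_disjoint E (\<U> i)) \<and> (\<exists>K\<in>\<E>. \<forall>i\<le>n. rel_bounded K (\<U> i))"
  proof (intro exI[of _ "\<lambda>i. range (cell i)"] conjI allI impI bexI[OF _ K])
    show "X \<subseteq> (\<Union>i\<le>n. \<Union> (range (cell i)))"
    proof
      fix x assume x: "x \<in> X"
      then have "x \<in> cell (col x) (key x)" by (simp add: cell_def)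
      then show "x \<in> (\<Union>i\<le>n. \<Union> (range (cell i)))" using col[OF x] by blast
    qed
  next
    fix i
    show "rel_disjoint E (range (cell i))"
      unfolding rel_disjoint_def
    proof (intro ballI impI)
      fix U U' assume U: "U \<in> range (cell i)" "U' \<in> range (cell i)" "U \<noteq> U'"
      show "(U \<times> U') \<inter> E = {}"
      proof (rule ccontr)
        assume "(U \<times> U') \<inter> E \<noteq> {}"
        then obtain x y where xy: "x \<in> U" "y \<in> U'" "(x, y) \<in> E" by blast
        moreover obtain \<kappa> \<kappa>' where \<kappa>: "U = cell i \<kappa>" "U' = cell i \<kappa>'"
          using U by blast
        ultimately have "x \<in> X" "y \<in> X" "col x = col y" and key: "key x = \<kappa>" "key y = \<kappa>'"
          by (simp_all add: cell_def)
        then have "key x = key y" by (intro dis xy(3))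
        then show False using U(3) \<kappa> key by simp
      qed
    qed
    show "rel_bounded K (range (cell i))"
      by (auto simp: rel_bounded_def cell_def intro!: bdd)
  qed (auto simp: cell_def)
qed

text \<open>Each point picks a member of the cover that contains it: \<open>key\<close> is that
  member and \<open>col\<close> the index of its family. Points of one colour with different keys
  thus lie in distinct members of a disjoint family.\<close>

lemma asdim_le_partitionE:
  assumes "asdim_le X \<E> n" "E \<in> \<E>"
  obtains col :: "'a \<Rightarrow> nat" and key :: "'a \<Rightarrow> 'a set" and K where "K \<in> \<E>"
    "\<And>x. x \<in> X \<Longrightarrow> col x \<le> n"
    "\<And>x y. x \<in> X \<Longrightarrow> y \<in> X \<Longrightarrow> col x = col y \<Longrightarrow> (x, y) \<in> E \<Longrightarrow> key x = key y"
    "\<And>x y. x \<in> X \<Longrightarrow> y \<in> X \<Longrightarrow> col x = col y \<Longrightarrow> key x = key y \<Longrightarrow> (x, y) \<in> K"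
proof -
  obtain \<U> K where cov: "X \<subseteq> (\<Union>i\<le>n. \<Union>(\<U> i))"
    and dis: "\<And>i. i \<le> n \<Longrightarrow> rel_disjoint E (\<U> i)"
    and K: "K \<in> \<E>" and bdd: "\<And>i. i \<le> n \<Longrightarrow> rel_bounded K (\<U> i)"
    using assms unfolding asdim_le_def by metis
  have "\<forall>x\<in>X. \<exists>i U. i \<le> n \<and> U \<in> \<U> i \<and> x \<in> U"
    using cov by blast
  then obtain col key where ck: "\<And>x. x \<in> X \<Longrightarrow> col x \<le> n \<and> key x \<in> \<U> (col x) \<and> x \<in> key x"
    by metis
  show ?thesis
  proof (rule that[OF K])
    fix x y assume xy: "x \<in> X" "y \<in> X" "col x = col y"
    show "key x = key y" if "(x, y) \<in> E"
    proof (rule ccontr)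
      assume "key x \<noteq> key y"
      then have "(key x \<times> key y) \<inter> E = {}"
        using dis[of "col x"] ck[of x] ck[of y] xy by (simp add: rel_disjoint_def)
      then show False using that ck[of x] ck[of y] xy by blast
    qed
    show "(x, y) \<in> K" if "key x = key y"
      using bdd[of "col x"] ck[of x] ck[of y] xy that by (auto simp: rel_bounded_def)
  qed (use ck in blast)
qed

section \<open>The distance of an entourage\<close>

lemma ent_dist_le: "(x, y) \<in> ent_pow E k \<Longrightarrow> ent_dist E x y \<le> enat k"
  unfolding ent_dist_def by (rule Inf_lower) blast

text \<open>A finite infimum in \<open>enat\<close> comes from a nonempty set and is therefore
  attained.\<close>

lemma ent_dist_leD:
  assumes "ent_dist E x y \<le> enat n"
  obtains k where "k \<le> n" "ent_dist E x y = enat k" "(x, y) \<in> ent_pow E k"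
proof -
  let ?S = "{enat k |k. (x, y) \<in> ent_pow E k}"
  have "?S \<noteq> {}"
  proof
    assume "?S = {}"
    then have "ent_dist E x y = \<infinity>" unfolding ent_dist_def by (simp add: Inf_enat_def)
    then show False using assms by simp
  qed
  then have "Inf ?S \<in> ?S"
    unfolding Inf_enat_def using LeastI_ex[of "\<lambda>x. x \<in> ?S"] by (metis (lifting) ex_in_conv)
  then obtain k where "ent_dist E x y = enat k" "(x, y) \<in> ent_pow E k"
    unfolding ent_dist_def by auto
  then show ?thesis using that assms by simp
qed

lemma ent_pow_mono: "E \<subseteq> F \<Longrightarrow> ent_pow E k \<subseteq> ent_pow F k"
  using relpowp_mono[of "\<lambda>x y. (x, y) \<in> E" "\<lambda>x y. (x, y) \<in> F" k]
  by (auto simp: ent_pow_def relpowp_relpow_eq)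

lemma ent_pow_comp: "(x, y) \<in> ent_pow E k \<Longrightarrow> (y, z) \<in> ent_pow E l \<Longrightarrow> (x, z) \<in> ent_pow E (k + l)"
  by (auto simp: ent_pow_def relpow_add split: if_splits)

lemma sym_relpow: "sym E \<Longrightarrow> sym (E ^^ k)"
proof (induction k)
  case (Suc k)
  \<comment> \<open>A reversed chain has its extra factor at the other end;
    \<open>relpow_commute\<close> moves it back.\<close>
  then show ?case using relpow_commute[of E k] by (fastforce simp: sym_def relcomp_unfold)
qed (simp add: sym_def)

lemma ent_pow_sym: "sym E \<Longrightarrow> (x, y) \<in> ent_pow E k \<Longrightarrow> (y, x) \<in> ent_pow E k"
  by (auto simp: ent_pow_def dest: sym_relpow[THEN symD] split: if_splits)

lemma ent_dist_mono:
  assumes "E \<subseteq> F"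
  shows "ent_dist F x y \<le> ent_dist E x y"
proof (cases "ent_dist E x y")
  case (enat n)
  then obtain k where "ent_dist E x y = enat k" "(x, y) \<in> ent_pow E k"
    using ent_dist_leD[of E x y n] by auto
  then show ?thesis using ent_dist_le ent_pow_mono[OF assms] by (metis subsetD)
qed simp

lemma ent_dist_triangle: "ent_dist E x z \<le> ent_dist E x y + ent_dist E y z"
proof (cases "ent_dist E x y")
  case d: (enat d)
  show ?thesis
  proof (cases "ent_dist E y z")
    case e: (enat e)
    have "(x, y) \<in> ent_pow E d" "(y, z) \<in> ent_pow E e"
      using ent_dist_leD[of E x y d] ent_dist_leD[of E y z e] d e by auto
    then show ?thesis using ent_dist_le[OF ent_pow_comp] d e by (metis plus_enat_simps(1))
  qed simp
qed simp

lemma ent_dist_sym_le: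
  assumes "sym E"
  shows "ent_dist E x y \<le> ent_dist E y x"
proof (cases "ent_dist E y x")
  case (enat n)
  then obtain k where "ent_dist E y x = enat k" "(y, x) \<in> ent_pow E k"
    using ent_dist_leD[of E y x n] by auto
  then show ?thesis using ent_dist_le ent_pow_sym[OF assms] by metis
qed simp

lemma ent_dist_sym: "sym E \<Longrightarrow> ent_dist E x y = ent_dist E y x"
  by (simp add: antisym ent_dist_sym_le)

lemma ent_dist_self: "(x, x) \<in> E \<Longrightarrow> ent_dist E x x = 0"
  using ent_dist_le[of x x E 0] by (simp add: ent_pow_def zero_enat_def[symmetric])

context coarse_space
begin

lemma ent_pow_closed:
  assumes "E \<in> \<E>"
  shows "ent_pow E k \<in> \<E>"
proof (cases k)
  case 0
  then show ?thesis using assms subset_closed by (auto simp: ent_pow_def)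
next
  case (Suc m)
  have "E ^^ Suc m \<in> \<E>"
  proof (induction m)
    case (Suc m)
    then show ?case using comp_closed[OF Suc assms] by simp
  qed (use assms in simp)
  then show ?thesis using Suc by (simp add: ent_pow_def)
qed

text \<open>This entourage contains all pairs at \<open>E\<close>-distance at most \<open>n\<close>;
  it is the scale at which \<open>X\<close> gets covered.\<close>

lemma Union_ent_pow_closed:
  assumes "E \<in> \<E>"
  shows "(\<Union>k\<le>n. ent_pow E k) \<in> \<E>"
proof (induction n)
  case (Suc n)
  then show ?case
    using union_closed[OF ent_pow_closed[OF assms] Suc] by (simp add: atMost_Suc)
qed (use ent_pow_closed[OF assms] in simp)

end

section \<open>The distance of words\<close>

lemma norm_out_mono: "E \<subseteq> F \<Longrightarrow> norm_out x0 F w \<le> norm_out x0 E w"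
  unfolding norm_out_def by (intro sum_list_mono ent_dist_mono)

lemma norm_in_mono: "E \<subseteq> F \<Longrightarrow> norm_in x0 F w \<le> norm_in x0 E w"
  unfolding norm_in_def by (intro sum_list_mono ent_dist_mono)

lemma norm_in_eq_norm_out: "sym E \<Longrightarrow> norm_in x0 E w = norm_out x0 E w"
  by (simp add: norm_in_def norm_out_def ent_dist_sym[of E _ x0])

lemma word_dist_mono: "E \<subseteq> F \<Longrightarrow> word_dist x0 F w w' \<le> word_dist x0 E w w'"
  unfolding word_dist_def Let_def
  by (auto intro!: add_mono ent_dist_mono norm_out_mono norm_in_mono)

lemma word_ent_mono: "E \<subseteq> F \<Longrightarrow> word_ent X x0 E n \<subseteq> word_ent X x0 F n"
  unfolding word_ent_def by (auto intro: order_trans[OF word_dist_mono])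

text \<open>Used with \<open>lcp_split\<close>: the distance is read off a factorisation whose
  remainders have no first letter in common.\<close>

lemma word_dist_append:
  assumes "s \<noteq> s'" "longest_common_prefix s s' = []"
  shows "word_dist x0 E (p @ s) (p @ s') = ent_dist E (first_letter x0 s) (first_letter x0 s')
    + norm_out x0 E (tl s) + norm_in x0 E (tl s')"
proof -
  have "longest_common_prefix (p @ s) (p @ s') = p"
    using assms(2) by (induction p) auto
  then show ?thesis using assms(1) by (simp add: word_dist_def)
qed

lemma lcp_split:
  obtains p s s' where "w = p @ s" "w' = p @ s'" "longest_common_prefix s s' = []"
proof -
  have "\<exists>p s s'. w = p @ s \<and> w' = p @ s' \<and> longest_common_prefix s s' = []"
  proof (induction w w' rule: longest_common_prefix.induct)
    case (1 x xs y ys)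
    show ?case
    proof (cases "x = y")
      case True
      then show ?thesis using 1 by (metis append_Cons)
    next
      case False
      then show ?thesis by (intro exI[of _ "[]"] exI[of _ "x # xs"] exI[of _ "y # ys"]) simp
    qed
  next
    case ("2_1" ys)
    show ?case by (intro exI[of _ "[]"] exI[of _ ys]) simp
  next
    case ("2_2" xs)
    show ?case by (intro exI[of _ "[]"] exI[of _ xs]) simp
  qed
  then show ?thesis using that by blast
qed

text \<open>The empty word is included: its first letter is \<open>x0\<close>, at distance 0 from
  itself because \<open>(x0, x0)\<close> lies in \<open>E\<close>.\<close>

lemma norm_out_first_letter:
  assumes "(x0, x0) \<in> E"
  shows "ent_dist E x0 (first_letter x0 s) + norm_out x0 E (tl s) = norm_out x0 E s"
  using ent_dist_self[OF assms] by (cases s) (auto simp: first_letter_def norm_out_def)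

text \<open>Detour through the basepoint where the words diverge: the triangle inequality replaces
  the distance of the two letters by their distances to \<open>x0\<close>, which complete the norms
  of the tails.\<close>

lemma word_dist_le_norms:
  assumes E: "sym E" "(x0, x0) \<in> E"
  shows "word_dist x0 E (p @ c) (p @ c') \<le> norm_out x0 E c + norm_out x0 E c'"
proof (cases "c = c'")
  case False
  obtain q s s' where q: "c = q @ s" "c' = q @ s'" "longest_common_prefix s s' = []"
    by (rule lcp_split)
  let ?f = "first_letter x0"
  have "word_dist x0 E (p @ c) (p @ c') =
      ent_dist E (?f s) (?f s') + norm_out x0 E (tl s) + norm_out x0 E (tl s')"
    using word_dist_append[of s s' x0 E "p @ q"] q False by (simp add: norm_in_eq_norm_out E)
  also have "\<dots> \<le> (ent_dist E (?f s) x0 + ent_dist E x0 (?f s')) + norm_out x0 E (tl s) + norm_out x0 E (tl s')"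
    by (intro add_mono ent_dist_triangle) auto
  also have "\<dots> = norm_out x0 E s + norm_out x0 E s'"
    unfolding norm_out_first_letter[OF E(2), of s, symmetric]
      norm_out_first_letter[OF E(2), of s', symmetric] ent_dist_sym[OF E(1), of "?f s" x0]
    by (simp add: ac_simps)
  also have "\<dots> \<le> norm_out x0 E c + norm_out x0 E c'"
    by (intro add_mono) (simp_all add: q norm_out_def)
  finally show ?thesis .
qed (simp add: word_dist_def)

lemma enat_add3_leE:
  assumes "a + b + c \<le> enat n"
  obtains d e e' where "a = enat d" "b = enat e" "c = enat e'" "d + e + e' \<le> n"
  using assms by (cases a; cases b; cases c) auto

text \<open>For equal words the prefix is the whole word and both remainders are empty, so later
  arguments treat all close pairs alike.\<close>

lemma word_dist_split:
  assumes E: "sym E" "(x0, x0) \<in> E" and le: "word_dist x0 E w w' \<le> enat n"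
  obtains p s s' d e e' where "w = p @ s" "w' = p @ s'"
    "ent_dist E (first_letter x0 s) (first_letter x0 s') = enat d"
    "norm_out x0 E (tl s) = enat e" "norm_out x0 E (tl s') = enat e'" "d + e + e' \<le> n"
proof (cases "w = w'")
  case True
  have "ent_dist E (first_letter x0 []) (first_letter x0 []) = enat 0"
    "norm_out x0 E (tl []) = enat 0"
    using ent_dist_self[OF E(2)] by (simp_all add: first_letter_def norm_out_def zero_enat_def)
  then show ?thesis by (intro that[of w "[]" "[]" 0 0 0]) (simp_all add: True)
next
  case False
  obtain p s s' where p: "w = p @ s" "w' = p @ s'" "longest_common_prefix s s' = []"
    by (rule lcp_split)
  have "ent_dist E (first_letter x0 s) (first_letter x0 s') + norm_out x0 E (tl s) + norm_out x0 E (tl s') \<le> enat n"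
    using le word_dist_append[of s s' x0 E p] p False by (simp add: norm_in_eq_norm_out E)
  then obtain d e e' where "ent_dist E (first_letter x0 s) (first_letter x0 s') = enat d"
      "norm_out x0 E (tl s) = enat e" "norm_out x0 E (tl s') = enat e'" "d + e + e' \<le> n"
    by (rule enat_add3_leE)
  then show ?thesis by (rule that[OF p(1,2)])
qed

section \<open>Stems\<close>

text \<open>The shortest prefix of weight at least \<open>T\<close>, or the whole word if there is none.\<close>

fun stem :: "('a \<Rightarrow> nat) \<Rightarrow> nat \<Rightarrow> 'a list \<Rightarrow> 'a list" where
  "stem f T [] = []"
| "stem f T (x # xs) = (if T = 0 then [] else x # stem f (T - f x) xs)"

lemma stem_0 [simp]: "stem f 0 w = []"
  by (cases w) auto

lemma stem_append:
  "stem f T (p @ s) = (if T \<le> sum_list (map f p) then stem f T p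
     else p @ stem f (T - sum_list (map f p)) s)"
  by (induction p arbitrary: T) auto

lemma stem_prefix:
  "T \<le> sum_list (map f w) \<Longrightarrow> \<exists>c. w = stem f T w @ c \<and> T \<le> sum_list (map f (stem f T w))"
proof (induction w arbitrary: T)
  case (Cons x w)
  then obtain c where "w = stem f (T - f x) w @ c" "T - f x \<le> sum_list (map f (stem f (T - f x) w))"
    by (metis (no_types, lifting) diff_le_mono diff_add_inverse list.simps(9) sum_list.Cons)
  then show ?case by auto
qed simp

section \<open>Weights\<close>

text \<open>A finite substitute for the distance from \<open>x0\<close>, so that every word has a
  height in \<open>nat\<close> even if some letter cannot be reached from \<open>x0\<close>.\<close>

definition weight :: "'a rel \<Rightarrow> 'a \<Rightarrow> nat \<Rightarrow> 'a \<Rightarrow> nat" where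
  "weight E x0 M x = (case ent_dist E x0 x of enat d \<Rightarrow> d | \<infinity> \<Rightarrow> M)"

text \<open>A letter at infinite distance makes the norm infinite and adds \<open>M\<close> to the
  sum, so either alternative excludes such letters.\<close>

lemma weight_eq_norm_out:
  assumes "norm_out x0 E w \<noteq> \<infinity> \<or> sum_list (map (weight E x0 M) w) < M"
  shows "norm_out x0 E w = enat (sum_list (map (weight E x0 M) w))"
  using assms
proof (induction w)
  case (Cons x w)
  show ?case
  proof (cases "ent_dist E x0 x")
    case (enat d)
    then have "norm_out x0 E (x # w) = enat d + norm_out x0 E w" "weight E x0 M x = d"
      by (simp_all add: norm_out_def weight_def)
    with Cons show ?thesis by (cases "norm_out x0 E w") auto
  next
    case infinity
    then show ?thesis using Cons.prems by (simp add: norm_out_def weight_def)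
  qed
qed (simp add: norm_out_def zero_enat_def)

text \<open>At finite distance, \<open>x\<close> and \<open>y\<close> are both reachable from
  \<open>x0\<close> or both not; in the latter case both weigh \<open>M\<close>.\<close>

lemma weight_Lipschitz:
  assumes "sym E" "ent_dist E x y = enat d"
  shows "weight E x0 M x \<le> weight E x0 M y + d"
proof -
  have "ent_dist E x0 x \<le> ent_dist E x0 y + enat d" "ent_dist E x0 y \<le> ent_dist E x0 x + enat d"
    using ent_dist_triangle[of E x0 x y] ent_dist_triangle[of E x0 y x] assms(2)
      ent_dist_sym[OF assms(1), of y x] by simp_all
  then show ?thesis
    by (cases "ent_dist E x0 x"; cases "ent_dist E x0 y") (auto simp: weight_def)
qed

lemma weight_first_letter:
  assumes "(x0, x0) \<in> E"
  shows "sum_list (map (weight E x0 M) s) =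
    weight E x0 M (first_letter x0 s) + sum_list (map (weight E x0 M) (tl s))"
  using ent_dist_self[OF assms]
  by (cases s) (auto simp: first_letter_def weight_def zero_enat_def)

text \<open>The prefix cancels, the first letter of \<open>s\<close> outweighs that of
  \<open>s'\<close> by at most \<open>d\<close>, and the tail of \<open>s\<close> weighs
  \<open>e\<close>.\<close>

lemma sum_weight_Lipschitz:
  assumes E: "sym E" "(x0, x0) \<in> E"
    and d: "ent_dist E (first_letter x0 s) (first_letter x0 s') = enat d"
    and e: "norm_out x0 E (tl s) = enat e" "d + e \<le> n"
  shows "sum_list (map (weight E x0 M) (p @ s)) \<le> sum_list (map (weight E x0 M) (p @ s')) + n"
proof -
  have "sum_list (map (weight E x0 M) (tl s)) = e"
    using weight_eq_norm_out[of x0 E "tl s" M] e by simp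
  then show ?thesis
    using weight_first_letter[OF E(2), of M s] weight_first_letter[OF E(2), of M s']
      weight_Lipschitz[OF E(1) d, of x0 M] e(2) by simp
qed

section \<open>The partition of the free product\<close>

text \<open>The tail of \<open>s\<close> weighs at most \<open>n\<close>, while the whole word
  exceeds the threshold by at least \<open>n\<close>. So the threshold, not met by \<open>p\<close>,
  is met at the first letter of \<open>s\<close>, and the stem stops there.\<close>

lemma stem_branch:
  assumes E: "(x0, x0) \<in> E" and e: "norm_out x0 E (tl s) = enat e" "e \<le> n"
    and T: "sum_list (map (weight E x0 M) p) < T"
      "T + n \<le> sum_list (map (weight E x0 M) (p @ s))"
  shows "stem (weight E x0 M) T (p @ s) = p @ [first_letter x0 s]"
proof -
  let ?f = "weight E x0 M"
  have "sum_list (map ?f (tl s)) = e"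
    using weight_eq_norm_out[of x0 E "tl s" M] e by simp
  then have *: "T - sum_list (map ?f p) \<le> ?f (first_letter x0 s)"
    using weight_first_letter[OF E, of M s] T e(2) by simp
  have "s \<noteq> []" using T by auto
  then obtain q r where s: "s = q # r" by (cases s) auto
  have "stem ?f (T - sum_list (map ?f p)) s = [q]"
    using * T(1) s by (simp add: first_letter_def)
  then show ?thesis using T(1) s by (simp add: stem_append first_letter_def)
qed

lemma ent_dist_1: "(x, y) \<in> E \<Longrightarrow> ent_dist E x y \<le> enat 1"
  by (rule ent_dist_le) (simp add: ent_pow_def)

text \<open>If \<open>q = q'\<close>, the letter joins the common prefix; otherwise it costs at most
  one step of \<open>F\<close>. Symmetry is available for \<open>E\<close>, so the tails are
  measured in \<open>E\<close> and compared by monotonicity.\<close>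

lemma word_dist_le_of_branch:
  assumes E: "sym E" "(x0, x0) \<in> E" "E \<subseteq> F" and qq: "(q, q') \<in> F"
    and c: "norm_out x0 E c \<le> enat r" "norm_out x0 E c' \<le> enat r"
  shows "word_dist x0 F (a @ q # c) (a @ q' # c') \<le> enat (2 * r + 1)"
proof (cases "q = q'")
  case True
  have "word_dist x0 F (a @ q # c) (a @ q' # c') \<le> word_dist x0 E ((a @ [q]) @ c) ((a @ [q]) @ c')"
    using word_dist_mono[OF E(3)] True by simp
  also have "\<dots> \<le> norm_out x0 E c + norm_out x0 E c'"
    by (rule word_dist_le_norms[OF E(1,2)])
  also have "\<dots> \<le> enat r + enat r" by (intro add_mono c)
  finally show ?thesis by (rule order_trans) simp
next
  case False
  have "word_dist x0 F (a @ q # c) (a @ q' # c') =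
      ent_dist F q q' + norm_out x0 F c + norm_in x0 F c'"
    using word_dist_append[of "q # c" "q' # c'" x0 F a] False by (simp add: first_letter_def)
  also have "\<dots> \<le> enat 1 + enat r + enat r"
    using c norm_out_mono[OF E(3), of x0 c] norm_in_mono[OF E(3), of x0 c']
    by (intro add_mono ent_dist_1[OF qq]) (auto simp: norm_in_eq_norm_out[OF E(1)])
  finally show ?thesis by (rule order_trans) simp
qed

theorem theorem5p7:
  fixes X :: "'a set" and \<E> :: "'a rel set" and x0 :: 'a and k :: nat
  assumes "coarse_space X \<E>"
    and "asdim_le X \<E> k"
    and "x0 \<in> X"
  shows "asdim_le (words X x0) (free_product_structure X x0 \<E>) (2 * k + 1)"
proof (rule asdim_le_partitionI)
  fix F assume "F \<in> free_product_structure X x0 \<E>"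
  then obtain E0 n where E0: "E0 \<in> \<E>" and F: "F \<subseteq> word_ent X x0 E0 n"
    by (auto simp: free_product_structure_def)
  interpret coarse_space X \<E> by fact
  \<comment> \<open>Making the entourage symmetric and reflexive only enlarges the word entourage,
    and it makes both norms agree.\<close>
  define E where "E = E0 \<union> E0\<inverse> \<union> Id_on X"
  have E: "E \<in> \<E>"
    unfolding E_def by (intro union_closed converse_closed diagonal E0)
  have symE: "sym E" and reflE: "(x0, x0) \<in> E"
    using assms(3) by (auto simp: E_def sym_def)
  have FE: "word_dist x0 E w w' \<le> enat n" if "(w, w') \<in> F" for w w'
    using that F word_ent_mono[of E0 E X x0 n] by (auto simp: E_def word_ent_def)
  obtain col and key :: "'a \<Rightarrow> 'a set" and K where K: "K \<in> \<E>" and col: "\<And>x. x \<in> X \<Longrightarrow> col x \<le> k"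
    and dis: "\<And>x y. x \<in> X \<Longrightarrow> y \<in> X \<Longrightarrow> col x = col y \<Longrightarrow> (x, y) \<in> (\<Union>i\<le>n. ent_pow E i) \<Longrightarrow> key x = key y"
    and bdd: "\<And>x y. x \<in> X \<Longrightarrow> y \<in> X \<Longrightarrow> col x = col y \<Longrightarrow> key x = key y \<Longrightarrow> (x, y) \<in> K"
    by (rule asdim_le_partitionE[OF assms(2) Union_ent_pow_closed[OF E, of n]]) (rule that)
  \<comment> \<open>As \<open>R > n\<close>, words whose heights differ by at most \<open>n\<close>
    have levels differing by at most 1.\<close>
  define R where "R = Suc n"
  \<comment> \<open>The remainders after the stems will weigh less than \<open>2 * R\<close>, so the
    default \<open>3 * R\<close> rules out unreachable letters in them.\<close>
  define f where "f = weight E x0 (3 * R)"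
  define h where "h w = sum_list (map f w)" for w
  define level where "level w = h w div R" for w
  \<comment> \<open>Lowering the threshold by \<open>n\<close> gives the slack that
    \<open>stem_branch\<close> requires. On level 0, truncated subtraction yields threshold 0 and an
    empty stem.\<close>
  define u where "u w = stem f (level w * R - n) w" for w
  \<comment> \<open>\<open>x0\<close> is only a default for the empty stem on level 0.\<close>
  define b where "b w = last (x0 # u w)" for w
  define col' where "col' w = 2 * col (b w) + level w mod 2" for w
  \<comment> \<open>Of the last letter of the stem only its key is recorded, so the words of a cell
    may branch there.\<close>
  define key' where "key' w = (level w, butlast (u w), key (b w))" for w
  have lev: "level w * R \<le> h w" "h w < level w * R + R" for w
    using dividend_less_div_times[of R "h w"] div_times_less_eq_dividend[of "h w" R]
    by (simp_all add: level_def R_def)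
  obtain c where c: "\<And>w. w = u w @ c w" "\<And>w. level w * R - n \<le> h (u w)"
  proof -
    have "\<exists>c. w = u w @ c \<and> level w * R - n \<le> h (u w)" for w
      using stem_prefix[of "level w * R - n" f w] lev(1)[of w] by (simp add: u_def h_def)
    then show ?thesis using that by metis
  qed
  have bX: "b w \<in> X" if "w \<in> words X x0" for w
  proof -
    have "set (u w) \<subseteq> set w" by (metis c(1) set_append Un_upper1)
    then have "set (x0 # u w) \<subseteq> X" using that assms(3) by (auto simp: words_def)
    then show ?thesis unfolding b_def using last_in_set by blast
  qed
  have c_norm: "norm_out x0 E (c w) \<le> enat (2 * R)" for w
  proof -
    have "h w = h (u w) + h (c w)"
      by (subst c(1)[of w]) (simp only: h_def map_append sum_list_append)
    \<comment> \<open>\<open>h w\<close> is below \<open>level w * R + R\<close> and the stem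
      carries at least \<open>level w * R - n\<close>, so less than \<open>R + n\<close>
      remains.\<close>
    then have "h (c w) < 2 * R"
      using c(2)[of w] lev[of w] by (simp add: R_def)
    then show ?thesis
      using weight_eq_norm_out[of x0 E "c w" "3 * R"] by (simp add: h_def f_def)
  qed
  have level_near: "level w \<le> level w' + 1" if "h w \<le> h w' + n" for w w'
  proof -
    have "h w div R \<le> (h w' + R) div R" using that by (intro div_le_mono) (simp add: R_def)
    then show ?thesis by (simp add: level_def R_def del: add_Suc_right)
  qed
  have key_eq: "key' w = key' w'"
    if W: "w \<in> words X x0" "w' \<in> words X x0" and eq: "col' w = col' w'" and ww: "(w, w') \<in> F" for w w'
  proof -
    obtain p s s' d e e' where p: "w = p @ s" "w' = p @ s'"
      and d: "ent_dist E (first_letter x0 s) (first_letter x0 s') = enat d"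
      and e: "norm_out x0 E (tl s) = enat e" "norm_out x0 E (tl s') = enat e'"
      and n: "d + e + e' \<le> n"
      by (rule word_dist_split[OF symE reflE FE[OF ww]])
    have d': "ent_dist E (first_letter x0 s') (first_letter x0 s) = enat d"
      using d ent_dist_sym[OF symE] by metis
    have "h w \<le> h w' + n"
      using sum_weight_Lipschitz[OF symE reflE d e(1), of n "3 * R" p] n p by (simp add: h_def f_def)
    moreover have "h w' \<le> h w + n"
      using sum_weight_Lipschitz[OF symE reflE d' e(2), of n "3 * R" p] n p by (simp add: h_def f_def)
    ultimately have "level w \<le> level w' + 1" "level w' \<le> level w + 1"
      using level_near by blast+
    moreover have par: "level w mod 2 = level w' mod 2" "col (b w) = col (b w')"
      using eq unfolding col'_def by presburger+
    \<comment> \<open>Adjacent levels have different parity, so equal colours force equal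
      levels.\<close>
    ultimately have L: "level w = level w'" by presburger
    define T where "T = level w * R - n"
    have u: "u w = stem f T (p @ s)" "u w' = stem f T (p @ s')"
      using p L by (simp_all add: u_def T_def)
    show ?thesis
    \<comment> \<open>If the threshold is met inside the common prefix, the stems coincide.
      Otherwise both stems end one letter after \<open>p\<close>, and these two letters are at
      distance at most \<open>n\<close>.\<close>
    proof (cases "T \<le> sum_list (map f p)")
      case True
      then show ?thesis using u L by (simp add: key'_def b_def stem_append)
    next
      case False
      \<comment> \<open>Here \<open>T > 0\<close>, so the subtraction defining \<open>T\<close> was
        not truncated.\<close>
      then have T: "sum_list (map f p) < T" "T + n = level w * R"
        by (auto simp: T_def)
      have "u w = p @ [first_letter x0 s]"
        unfolding u f_def using e n T lev(1)[of w] p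
        by (intro stem_branch[OF reflE e(1), of n]) (auto simp: f_def h_def)
      moreover have "u w' = p @ [first_letter x0 s']"
        unfolding u f_def using e n T lev(1)[of w'] p L
        by (intro stem_branch[OF reflE e(2), of n]) (auto simp: f_def h_def)
      ultimately have b: "b w = first_letter x0 s" "b w' = first_letter x0 s'"
        and bl: "butlast (u w) = butlast (u w')"
        by (auto simp: b_def)
      have "ent_dist E (b w) (b w') \<le> enat n"
        using d b n by simp
      then obtain i where "i \<le> n" "(b w, b w') \<in> ent_pow E i"
        by (rule ent_dist_leD)
      then have "key (b w) = key (b w')"
        using dis[OF bX[OF W(1)] bX[OF W(2)] par(2)] by blast
      then show ?thesis using L bl by (simp add: key'_def)
    qed
  qed
  have near: "(w, w') \<in> word_ent X x0 (K \<union> E) (4 * R + 1)"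
    if W: "w \<in> words X x0" "w' \<in> words X x0" and eq: "col' w = col' w'" and keq: "key' w = key' w'" for w w'
  proof -
    have L: "level w = level w'" "butlast (u w) = butlast (u w')" "key (b w) = key (b w')"
      using keq by (auto simp: key'_def)
    have "col (b w) = col (b w')" using eq L(1) by (simp add: col'_def)
    then have bb: "(b w, b w') \<in> K \<union> E"
      using bdd bX W L(3) by blast
    \<comment> \<open>On a positive level the threshold is at least 1, since \<open>R > n\<close>,
      so the empty word cannot meet it.\<close>
    have u_Nil: "u v = [] \<longleftrightarrow> level v = 0" for v
    proof
      assume "u v = []"
      then have "level v * R \<le> n" using c(2)[of v] by (simp add: h_def)
      then show "level v = 0" by (cases "level v") (auto simp: R_def)
    qed (simp add: u_def)
    \<comment> \<open>The remainders after the stems have norm at most \<open>2 * R\<close> each,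
      and the branching letters add at most 1.\<close>
    have "word_dist x0 (K \<union> E) w w' \<le> enat (2 * (2 * R) + 1)"
    \<comment> \<open>On level 0 there is no branching letter: the remainder is the whole
      word.\<close>
    proof (cases "level w = 0")
      case True
      then have "u w = []" "u w' = []" using u_Nil L(1) by auto
      then have "w = c w" "w' = c w'" using c(1)[of w] c(1)[of w'] by auto
      then have "word_dist x0 E w w' \<le> norm_out x0 E (c w) + norm_out x0 E (c w')"
        using word_dist_le_norms[OF symE reflE, of "[]" w w'] by simp
      also have "\<dots> \<le> enat (2 * R) + enat (2 * R)" by (intro add_mono c_norm)
      finally have "word_dist x0 E w w' \<le> enat (2 * (2 * R) + 1)"
        by (rule order_trans) simp
      then show ?thesis by (meson word_dist_mono Un_upper2 order_trans)
    next
      case False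
      have split: "v = butlast (u v) @ b v # c v" if "level v \<noteq> 0" for v
      proof -
        have "u v = butlast (u v) @ [b v]"
          using u_Nil that by (simp add: b_def)
        then show ?thesis using c(1)[of v] by (metis append.assoc append_Cons append_Nil)
      qed
      have "butlast (u w) @ b w # c w = w" "butlast (u w) @ b w' # c w' = w'"
        using split False L by metis+
      then show ?thesis
        using word_dist_le_of_branch[OF symE reflE Un_upper2 bb c_norm c_norm, of "butlast (u w)" w w']
        by (simp only:)
    qed
    then show ?thesis using W by (simp add: word_ent_def)
  qed
  have "word_ent X x0 (K \<union> E) (4 * R + 1) \<in> free_product_structure X x0 \<E>"
    using union_closed[OF K E] by (auto simp: free_product_structure_def)
  moreover have "col' w \<le> 2 * k + 1" if "w \<in> words X x0" for w
    using col[OF bX[OF that]] unfolding col'_def by presburger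
  ultimately show "\<exists>(col :: 'a list \<Rightarrow> nat) (key :: 'a list \<Rightarrow> nat \<times> 'a list \<times> 'a set).
      \<exists>K\<in>free_product_structure X x0 \<E>. \<forall>x\<in>words X x0. col x \<le> 2 * k + 1 \<and>
      (\<forall>y\<in>words X x0. col x = col y \<longrightarrow> ((x, y) \<in> F \<longrightarrow> key x = key y) \<and> (key x = key y \<longrightarrow> (x, y) \<in> K))"
    by (intro exI[of _ col'] exI[of _ key'] bexI[of _ "word_ent X x0 (K \<union> E) (4 * R + 1)"]
        ballI conjI impI) (assumption | (rule key_eq; assumption) | (rule near; assumption) | blast)+
qed

end
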